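(* Let $\mathcal{H}$ be a CCPSR manifold of dimension $n\geq1$. Then $\mathcal{H}$ is not singular at infinity if and only if $\mathcal{H}$ has regular boundary behaviour.
   Context: Let $h:\mathbb{R}^{n+1}\to\mathbb{R}$ be a homogeneous cubic polynomial and $\partial^2h_p$ its Hessian bilinear form at $p$. A point $p$ with $h(p)>0$ is a hyperbolic point of $h$ if $-\partial^2h_p$ has signature $(n,1)$ ($n$ positive, one negative direction). An $n$-dimensional CCPSR (closed connected projective special real) manifold is a nonempty (relatively) open subset $\mathcal{H}$ of a level set $\{h=1\}\subset\mathbb{R}^{n+1}$ of such an $h$, consisting only of hyperbolic points of $h$, which is connected and closed as a subset of $\mathbb{R}^{n+1}$. Let $U=\mathbb{R}_{>0}\cdot\mathcal{H}$ be the cone spanned by $\mathcal{H}$ (an open convex cone). $\mathcal{H}$ is singular at infinity if there exists $p\in\partial U\setminus\{0\}$ with $dh_p=0$. $\mathcal{H}$ has regular boundary behaviour if (i) $dh_p\neq0$ for all $p\in\partial U\setminus\{0\}$, i.e. $\mathcal{H}$ is not singular at infinity (so $\partial U\setminus\{0\}$ is a smooth hypersurface), and (ii) for all $p\in\partial U\setminus\{0\}$ the restriction of $-\partial^2h_p$ to $T_p(\partial U\setminus\{0\})$ is positive semidefinite with kernel of dimension $1$. *)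

theory Defs
  imports "HOL-Analysis.Analysis"
begin

definition homogeneous_cubic :: "(real ^ 'm \<Rightarrow> real) \<Rightarrow> bool" where
  "homogeneous_cubic h \<longleftrightarrow>
     (\<exists>a. \<forall>x. h x = (\<Sum>i\<in>UNIV. \<Sum>j\<in>UNIV. \<Sum>k\<in>UNIV. a i j k * x $ i * x $ j * x $ k))"

definition hessian :: "('a::real_normed_vector \<Rightarrow> real) \<Rightarrow> 'a \<Rightarrow> 'a \<Rightarrow> 'a \<Rightarrow> real" where
  "hessian h p u v = frechet_derivative (\<lambda>q. frechet_derivative h (at q) v) (at p) u"

text \<open>
  Signature of a symmetric bilinear form, read off from an orthogonal basis: \<open>r\<close> is the number
  of positive and \<open>s\<close> the number of negative diagonal entries. The remaining basis vectors
  span the kernel of the form.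
\<close>

definition has_signature :: "('a::euclidean_space \<Rightarrow> 'a \<Rightarrow> real) \<Rightarrow> nat \<Rightarrow> nat \<Rightarrow> bool" where
  "has_signature B r s \<longleftrightarrow>
     (\<exists>E. independent E \<and> span E = UNIV \<and>
          (\<forall>u\<in>E. \<forall>v\<in>E. u \<noteq> v \<longrightarrow> B u v = 0) \<and>
          card {v \<in> E. B v v > 0} = r \<and> card {v \<in> E. B v v < 0} = s)"

definition hyperbolic_point :: "nat \<Rightarrow> (real ^ 'm \<Rightarrow> real) \<Rightarrow> real ^ 'm \<Rightarrow> bool" where
  "hyperbolic_point n h p \<longleftrightarrow> h p > 0 \<and> has_signature (\<lambda>u v. - hessian h p u v) n 1"

text \<open>
  The ambient space of an \<open>n\<close>-dimensional CCPSR manifold has dimension \<open>n + 1\<close>; this is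
  the condition on the size of the index type. The cubic \<open>h\<close> is carried along as an argument.
\<close>

definition CCPSR_manifold :: "nat \<Rightarrow> (real ^ 'm \<Rightarrow> real) \<Rightarrow> (real ^ 'm) set \<Rightarrow> bool" where
  "CCPSR_manifold n h H \<longleftrightarrow>
     CARD('m) = n + 1 \<and> homogeneous_cubic h \<and>
     H \<noteq> {} \<and> openin (top_of_set {x. h x = 1}) H \<and>
     (\<forall>p\<in>H. hyperbolic_point n h p) \<and> connected H \<and> closed H"

definition cone_over :: "'a::real_vector set \<Rightarrow> 'a set" where
  "cone_over H = {r *\<^sub>R x | r x. r > 0 \<and> x \<in> H}"

definition singular_at_infinity :: "(real ^ 'm \<Rightarrow> real) \<Rightarrow> (real ^ 'm) set \<Rightarrow> bool" where
  "singular_at_infinity h H \<longleftrightarrow>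
     (\<exists>p \<in> frontier (cone_over H) - {0}. frechet_derivative h (at p) = (\<lambda>v. 0))"

text \<open>
  Velocities at \<open>p\<close> of curves of class \<open>C\<^sup>1\<close> running in \<open>S\<close>. The definition makes sense for
  every set \<open>S\<close>; when \<open>S\<close> is an embedded submanifold it is the usual tangent space, a linear
  subspace.
\<close>

definition tangent_space :: "'a::real_normed_vector set \<Rightarrow> 'a \<Rightarrow> 'a set" where
  "tangent_space S p =
     {v. \<exists>\<gamma> e. e > 0 \<and> \<gamma> C1_differentiable_on {-e<..<e} \<and> \<gamma> ` {-e<..<e} \<subseteq> S \<and>
               \<gamma> 0 = p \<and> (\<gamma> has_vector_derivative v) (at 0)}"

definition psd_on :: "'a set \<Rightarrow> ('a \<Rightarrow> 'a \<Rightarrow> real) \<Rightarrow> bool" where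
  "psd_on T B \<longleftrightarrow> (\<forall>v\<in>T. B v v \<ge> 0)"

definition kernel_on :: "'a set \<Rightarrow> ('a \<Rightarrow> 'a \<Rightarrow> real) \<Rightarrow> 'a set" where
  "kernel_on T B = {v \<in> T. \<forall>w\<in>T. B v w = 0}"

text \<open>
  The first conjunct makes the punctured boundary of the cone a smooth hypersurface, so the
  tangent spaces in the second conjunct are linear and \<^const>\<open>dim\<close> is the dimension of the kernel.
\<close>

definition regular_boundary_behaviour :: "(real ^ 'm \<Rightarrow> real) \<Rightarrow> (real ^ 'm) set \<Rightarrow> bool" where
  "regular_boundary_behaviour h H \<longleftrightarrow>
     (\<forall>p \<in> frontier (cone_over H) - {0}. frechet_derivative h (at p) \<noteq> (\<lambda>v. 0)) \<and>
     (\<forall>p \<in> frontier (cone_over H) - {0}.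
        let T = tangent_space (frontier (cone_over H) - {0}) p;
            B = (\<lambda>u v. - hessian h p u v)
        in psd_on T B \<and> dim (kernel_on T B) = 1)"

end

theory Submission
  imports Defs
begin

text \<open>
  Let \<open>F\<close> be the symmetric trilinear form with \<open>h x = F x x x\<close>, so that the differential of \<open>h\<close> at
  \<open>p\<close> is \<open>3 F p p\<close> and its Hessian \<open>6 F p\<close>. By hyperbolicity \<open>- F x\<close> is positive definite on the
  kernel of \<open>F x x\<close> for \<open>x\<close> in the cone \<open>U\<close>; hence \<open>U\<close> is convex and its closure contains no line.
  Let \<open>p \<noteq> 0\<close> be a boundary point with nonzero differential. Semidefiniteness at \<open>p\<close> follows by
  passing to the limit from the inside, and \<open>p\<close> itself lies in the kernel. A further kernel vector
  can be corrected by a multiple of \<open>p\<close> to a vector \<open>u\<close> with \<open>F p u = 0\<close>, and then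
  \<open>h (p + t u) = t^3 h u\<close>. Since \<open>p + t u\<close> is tangent to the boundary of the convex cone, \<open>h u = 0\<close>.
  If the differential vanishes nowhere on the punctured boundary, the line \<open>p + t u\<close> can then never
  leave the boundary, which forces \<open>u = 0\<close>.
\<close>

section \<open>Symmetric trilinear forms and the calculus of their cubics\<close>

locale symmetric_trilinear =
  fixes F :: "'a::euclidean_space \<Rightarrow> 'a \<Rightarrow> 'a \<Rightarrow> real"
  assumes swap12: "F x y z = F y x z"
    and swap23: "F x y z = F x z y"
    and linear3: "linear (F x y)"
begin

lemma linear2: "linear (\<lambda>y. F x y z)"
  using linear3[of x z] by (simp add: swap23[of x _ z])

lemma linear1: "linear (\<lambda>x. F x y z)"
  using linear2[of y z] by (simp add: swap12[of _ y z])

lemma add_simps: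
  "F (x + x') y z = F x y z + F x' y z"
  "F x (y + y') z = F x y z + F x y' z"
  "F x y (z + z') = F x y z + F x y z'"
  using linear_add[OF linear1] linear_add[OF linear2] linear_add[OF linear3] by auto

lemma diff_simps:
  "F (x - x') y z = F x y z - F x' y z"
  "F x (y - y') z = F x y z - F x y' z"
  "F x y (z - z') = F x y z - F x y z'"
  using linear_diff[OF linear1] linear_diff[OF linear2] linear_diff[OF linear3] by auto

lemma scale_simps [simp]:
  "F (c *\<^sub>R x) y z = c * F x y z"
  "F x (c *\<^sub>R y) z = c * F x y z"
  "F x y (c *\<^sub>R z) = c * F x y z"
  using linear_scale[OF linear1] linear_scale[OF linear2] linear_scale[OF linear3] by auto

lemma minus_simps [simp]:
  "F (- x) y z = - F x y z" "F x (- y) z = - F x y z" "F x y (- z) = - F x y z"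
  using linear_neg[OF linear1] linear_neg[OF linear2] linear_neg[OF linear3] by auto

lemma zero_simps [simp]: "F 0 y z = 0" "F x 0 z = 0" "F x y 0 = 0"
  using linear_0[OF linear1] linear_0[OF linear2] linear_0[OF linear3] by auto

lemma cube_add_scale:
  "F (x + t *\<^sub>R y) (x + t *\<^sub>R y) (x + t *\<^sub>R y) =
     F x x x + 3 * t * F x x y + 3 * t\<^sup>2 * F x y y + t ^ 3 * F y y y"
proof -
  have "F x y x = F x x y" "F y x x = F x x y" "F y x y = F x y y" "F y y x = F x y y"
    using swap12 swap23 by metis+
  then show ?thesis
    by (simp add: add_simps algebra_simps power2_eq_square power3_eq_cube)
qed

text \<open>Over a basis \<open>F\<close> becomes a polynomial in inner products, so limits,
  continuity and derivatives of \<open>F\<close> reduce to those of sums and products.\<close>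

lemma expand:
  "F x y z = (\<Sum>b\<in>Basis. \<Sum>c\<in>Basis. \<Sum>d\<in>Basis. (x \<bullet> b) * (y \<bullet> c) * (z \<bullet> d) * F b c d)"
proof -
  have 1: "F x y z = (\<Sum>b\<in>Basis. (x \<bullet> b) * F b y z)" for x y z
    by (subst euclidean_representation[of x, symmetric], subst linear_sum[OF linear1]) simp
  have 2: "F x y z = (\<Sum>c\<in>Basis. (y \<bullet> c) * F x c z)" for x y z
    by (subst euclidean_representation[of y, symmetric], subst linear_sum[OF linear2]) simp
  have 3: "F x y z = (\<Sum>d\<in>Basis. (z \<bullet> d) * F x y d)" for x y z
    by (subst euclidean_representation[of z, symmetric], subst linear_sum[OF linear3]) simp
  show ?thesis
    apply (subst 1, subst 2, subst 3)
    by (simp add: sum_distrib_left mult.assoc)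
qed

lemma tendsto [tendsto_intros]:
  assumes "(f \<longlongrightarrow> a) G" "(g \<longlongrightarrow> b) G" "(k \<longlongrightarrow> c) G"
  shows "((\<lambda>t. F (f t) (g t) (k t)) \<longlongrightarrow> F a b c) G"
  by (subst (1 2) expand, intro tendsto_intros assms)

lemma continuous_on [continuous_intros]:
  assumes "continuous_on S f" "continuous_on S g" "continuous_on S k"
  shows "continuous_on S (\<lambda>t. F (f t) (g t) (k t))"
  using assms unfolding continuous_on_def by (auto intro!: tendsto)

lemma has_derivative [derivative_intros]:
  assumes [derivative_intros]: "(f has_derivative f') (at x within S)"
    "(g has_derivative g') (at x within S)" "(k has_derivative k') (at x within S)"
  shows "((\<lambda>t. F (f t) (g t) (k t)) has_derivative
    (\<lambda>v. F (f' v) (g x) (k x) + F (f x) (g' v) (k x) + F (f x) (g x) (k' v))) (at x within S)"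
proof -
  have "((\<lambda>t. \<Sum>b\<in>Basis. \<Sum>c\<in>Basis. \<Sum>d\<in>Basis. (f t \<bullet> b) * (g t \<bullet> c) * (k t \<bullet> d) * F b c d)
    has_derivative
    (\<lambda>v. \<Sum>b\<in>Basis. \<Sum>c\<in>Basis. \<Sum>d\<in>Basis. ((f' v \<bullet> b) * (g x \<bullet> c) * (k x \<bullet> d) +
       (f x \<bullet> b) * (g' v \<bullet> c) * (k x \<bullet> d) + (f x \<bullet> b) * (g x \<bullet> c) * (k' v \<bullet> d)) * F b c d))
    (at x within S)"
    by (rule derivative_eq_intros assms refl | simp add: algebra_simps)+
  also have "(\<lambda>t. \<Sum>b\<in>Basis. \<Sum>c\<in>Basis. \<Sum>d\<in>Basis. (f t \<bullet> b) * (g t \<bullet> c) * (k t \<bullet> d) * F b c d)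
    = (\<lambda>t. F (f t) (g t) (k t))"
    by (simp add: expand[symmetric])
  also have "(\<lambda>v. \<Sum>b\<in>Basis. \<Sum>c\<in>Basis. \<Sum>d\<in>Basis. ((f' v \<bullet> b) * (g x \<bullet> c) * (k x \<bullet> d) +
       (f x \<bullet> b) * (g' v \<bullet> c) * (k x \<bullet> d) + (f x \<bullet> b) * (g x \<bullet> c) * (k' v \<bullet> d)) * F b c d)
    = (\<lambda>v. F (f' v) (g x) (k x) + F (f x) (g' v) (k x) + F (f x) (g x) (k' v))"
    by (simp only: distrib_right sum.distrib expand[symmetric])
  finally show ?thesis .
qed

lemma cube_has_derivative: "((\<lambda>x. F x x x) has_derivative (\<lambda>v. 3 * F p p v)) (at p)"
proof -
  have "F v p p = F p p v" "F p v p = F p p v" for v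
    using swap12 swap23 by metis+
  then show ?thesis
    by (auto intro!: derivative_eq_intros)
qed

lemma frechet_derivative_cube: "frechet_derivative (\<lambda>x. F x x x) (at p) = (\<lambda>v. 3 * F p p v)"
  by (rule frechet_derivative_at[OF cube_has_derivative, symmetric])

lemma hessian_cube: "hessian (\<lambda>x. F x x x) p u v = 6 * F p u v"
proof -
  have "((\<lambda>q. 3 * F q q v) has_derivative (\<lambda>u. 6 * F p u v)) (at p)"
    by (auto intro!: derivative_eq_intros simp: swap12[of _ p v])
  from frechet_derivative_at[OF this] show ?thesis
    unfolding hessian_def frechet_derivative_cube by metis
qed

end

section \<open>The hyperbolic cone: convexity, polar positivity, absence of lines\<close>

text \<open>\<open>closure_pos\<close> makes \<open>U\<close> relatively closed in the positivity
  set of the cubic; this is how closedness of the manifold enters. \<open>hyperbolic\<close>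
  expresses the Lorentzian signature through the orthogonal complement of the negative direction
  \<open>x\<close>.\<close>

locale hyperbolic_cone = symmetric_trilinear F
  for F :: "'a::euclidean_space \<Rightarrow> 'a \<Rightarrow> 'a \<Rightarrow> real" +
  fixes U :: "'a set"
  assumes open_U: "open U" and connected_U: "connected U" and nonempty: "U \<noteq> {}"
    and cone: "x \<in> U \<Longrightarrow> r > 0 \<Longrightarrow> r *\<^sub>R x \<in> U"
    and pos: "x \<in> U \<Longrightarrow> F x x x > 0"
    and closure_pos: "x \<in> closure U \<Longrightarrow> F x x x > 0 \<Longrightarrow> x \<in> U"
    and hyperbolic: "x \<in> U \<Longrightarrow> F x x v = 0 \<Longrightarrow> v \<noteq> 0 \<Longrightarrow> F x v v < 0"
begin

lemma closure_nonneg: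
  assumes "x \<in> closure U" shows "F x x x \<ge> 0"
proof -
  have "closed {x. F x x x \<ge> 0}"
    by (intro closed_Collect_le continuous_intros)
  moreover have "U \<subseteq> {x. F x x x \<ge> 0}"
    using pos less_imp_le by auto
  ultimately show ?thesis
    using assms closure_minimal by blast
qed

lemma frontier_iff: "x \<in> frontier U \<longleftrightarrow> x \<in> closure U \<and> F x x x = 0"
  unfolding frontier_def interior_open[OF open_U]
  using pos closure_pos[of x] closure_nonneg[of x] by force

text \<open>\<open>U\<close> is clopen in the positivity set of the cubic, so a connected subset of
  that set cannot leave \<open>U\<close>.\<close>

lemma connected_subset:
  assumes S: "connected S" "\<And>x. x \<in> S \<Longrightarrow> F x x x > 0" and a: "a \<in> S" "a \<in> U"
  shows "S \<subseteq> U"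
proof -
  have "S \<inter> U = S \<inter> closure U"
    using S(2) closure_pos closure_subset[of U] by blast
  then have "closedin (top_of_set S) (S \<inter> U)"
    by (metis closed_closure closedin_closed_Int)
  moreover have "openin (top_of_set S) (S \<inter> U)"
    using open_U by (simp add: openin_open_Int)
  ultimately have "S \<inter> U = S"
    using S(1) a unfolding connected_clopen by blast
  then show ?thesis by blast
qed

text \<open>At a critical point of the cubic on a line through the cone its second derivative is
  negative, so the cubic has no local minimum there.\<close>

lemma no_interior_min:
  assumes x: "x + t *\<^sub>R v \<in> U" and v: "v \<noteq> 0" and d: "d > 0"
    and le: "\<And>s. \<bar>s - t\<bar> < d \<Longrightarrow>
      F (x + t *\<^sub>R v) (x + t *\<^sub>R v) (x + t *\<^sub>R v) \<le> F (x + s *\<^sub>R v) (x + s *\<^sub>R v) (x + s *\<^sub>R v)"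
  shows False
proof -
  define y where "y = x + t *\<^sub>R v"
  define g where "g = (\<lambda>s. F y y y + 3 * s * F y y v + 3 * s\<^sup>2 * F y v v + s ^ 3 * F v v v)"
  have le': "g 0 \<le> g s" if "\<bar>s\<bar> < d" for s
  proof -
    have "x + (t + s) *\<^sub>R v = y + s *\<^sub>R v"
      by (simp add: y_def algebra_simps)
    then show ?thesis
      using le[of "t + s"] that by (simp add: g_def y_def[symmetric] cube_add_scale)
  qed
  have "(g has_real_derivative 3 * F y y v) (at 0)"
    unfolding g_def by (auto intro!: derivative_eq_intros)
  then have "3 * F y y v = 0"
    by (rule DERIV_local_min[OF _ d]) (use le' in auto)
  then have yyv: "F y y v = 0" by simp
  with hyperbolic x v have neg: "F y v v < 0"
    unfolding y_def by blast
  \<comment> \<open>Once the linear term is gone, \<open>g s - g 0\<close> is this expression times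
    the square of \<open>s\<close>, and its limit at \<open>0\<close> is negative.\<close>
  have "((\<lambda>s. 3 * F y v v + s * F v v v) \<longlongrightarrow> 3 * F y v v + 0 * F v v v) (at_right 0)"
    by (intro tendsto_intros)
  then have "eventually (\<lambda>s. 3 * F y v v + s * F v v v < 0) (at_right 0)"
    by (rule order_tendstoD) (use neg in simp)
  moreover have "eventually (\<lambda>s. s \<in> {0<..<d}) (at_right (0::real))"
    using d by (rule eventually_at_right_real)
  ultimately have "eventually (\<lambda>s::real. False) (at_right 0)"
  proof eventually_elim
    case (elim s)
    have "g s - g 0 = s\<^sup>2 * (3 * F y v v + s * F v v v)"
      by (simp add: g_def yyv power2_eq_square power3_eq_cube algebra_simps)
    also have "\<dots> < 0"
      using elim by (intro mult_pos_neg) auto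
    finally show ?case using le'[of s] elim by simp
  qed
  then show False by simp
qed

text \<open>The minimum over the compact segment exists and, by \<open>no_interior_min\<close>, sits
  at an endpoint.\<close>

lemma segment_min:
  assumes seg: "\<And>t. 0 \<le> t \<Longrightarrow> t \<le> 1 \<Longrightarrow> x + t *\<^sub>R v \<in> U" and t: "0 \<le> t" "t \<le> 1"
  shows "min (F x x x) (F (x + v) (x + v) (x + v)) \<le>
    F (x + t *\<^sub>R v) (x + t *\<^sub>R v) (x + t *\<^sub>R v)"
proof (cases "v = 0")
  case False
  define g where "g = (\<lambda>t. F (x + t *\<^sub>R v) (x + t *\<^sub>R v) (x + t *\<^sub>R v))"
  have "continuous_on {0..1} g"
    unfolding g_def by (intro continuous_intros)
  then obtain m where m: "m \<in> {0..1}" "\<And>s. s \<in> {0..1} \<Longrightarrow> g m \<le> g s"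
    using continuous_attains_inf[of "{0..1::real}" g] by auto
  have "m = 0 \<or> m = 1"
  proof (rule ccontr)
    assume "\<not> (m = 0 \<or> m = 1)"
    then have "0 < min m (1 - m)" using m(1) by auto
    then show False
      by (rule no_interior_min[rotated 2]) (use m(2) seg m(1) False in \<open>auto simp: g_def abs_less_iff\<close>)
  qed
  with m(2)[of t] t show ?thesis by (auto simp: g_def)
qed simp

text \<open>The points of \<open>U\<close> visible from \<open>x\<close> form a clopen subset of
  \<open>U\<close>. For closedness, \<open>segment_min\<close> bounds the cubic on the approximating
  segments below by its endpoint values. The bound survives in the limit, so the limit segment stays
  in the positivity set and hence in \<open>U\<close>.\<close>

lemma convex_U: "convex U"
proof -
  have "U \<subseteq> {y. closed_segment x y \<subseteq> U}" if x: "x \<in> U" for x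
  proof -
    define S where "S = {y \<in> U. closed_segment x y \<subseteq> U}"
    have "open S"
      unfolding open_contains_ball
    proof
      fix y assume y: "y \<in> S"
      obtain e where e: "e > 0" "(\<Union>z\<in>closed_segment x y. ball z e) \<subseteq> U"
        using y compact_subset_open_imp_ball_epsilon_subset[OF compact_segment open_U, of x y]
        by (auto simp: S_def)
      have "y' \<in> S" if y': "y' \<in> ball y e" for y'
      proof -
        have "(1 - t) *\<^sub>R x + t *\<^sub>R y' \<in> U" if t: "0 \<le> t" "t \<le> 1" for t
        proof -
          have "dist ((1 - t) *\<^sub>R x + t *\<^sub>R y) ((1 - t) *\<^sub>R x + t *\<^sub>R y') = t * dist y y'"
            using t by (simp add: dist_norm algebra_simps flip: scaleR_diff_right)
          also have "\<dots> \<le> dist y y'"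
            using t by (simp add: mult_left_le_one_le)
          also have "\<dots> < e" using y' by simp
          finally have "(1 - t) *\<^sub>R x + t *\<^sub>R y' \<in> ball ((1 - t) *\<^sub>R x + t *\<^sub>R y) e"
            by simp
          moreover have "(1 - t) *\<^sub>R x + t *\<^sub>R y \<in> closed_segment x y"
            using t by (auto simp: in_segment)
          ultimately show ?thesis using e(2) by blast
        qed
        then have "closed_segment x y' \<subseteq> U" by (auto simp: in_segment)
        then show ?thesis by (auto simp: S_def)
      qed
      then show "\<exists>e>0. ball y e \<subseteq> S" using e(1) by blast
    qed
    have "closedin (top_of_set U) S"
      unfolding closedin_limpt
    proof (intro conjI allI impI)
      show "S \<subseteq> U" by (auto simp: S_def)
      fix y assume "y islimpt S \<and> y \<in> U"
      then have yU: "y \<in> U" and "y \<in> closure S" by (auto simp: closure_def)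
      then obtain f where f: "\<And>k. f k \<in> S" "f \<longlonglongrightarrow> y"
        unfolding closure_sequential by blast
      have "x + t *\<^sub>R (y - x) \<in> U" if t: "0 \<le> t" "t \<le> 1" for t
      proof -
        let ?c = "\<lambda>z. F z z z"
        let ?z = "\<lambda>k. x + t *\<^sub>R (f k - x)"
        have segk: "x + s *\<^sub>R (f k - x) \<in> U" if s: "0 \<le> s" "s \<le> 1" for s k
        proof -
          have "x + s *\<^sub>R (f k - x) \<in> closed_segment x (f k)"
            using s by (auto simp: in_segment algebra_simps)
          then show ?thesis using f(1)[of k] by (auto simp: S_def)
        qed
        have lim: "?z \<longlonglongrightarrow> x + t *\<^sub>R (y - x)"
          by (intro tendsto_intros f)
        have "(\<lambda>k. min (?c x) (?c (f k))) \<longlonglongrightarrow> min (?c x) (?c y)"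
          by (intro tendsto_intros f)
        moreover have "(\<lambda>k. ?c (?z k)) \<longlonglongrightarrow> ?c (x + t *\<^sub>R (y - x))"
          by (intro tendsto_intros lim)
        moreover have "min (?c x) (?c (f k)) \<le> ?c (?z k)" for k
          using segment_min[OF segk[of _ k] t] by simp
        ultimately have "min (?c x) (?c y) \<le> ?c (x + t *\<^sub>R (y - x))"
          by (meson LIMSEQ_le)
        moreover have "0 < min (?c x) (?c y)" using pos x yU by simp
        ultimately have "0 < ?c (x + t *\<^sub>R (y - x))" by (rule less_le_trans[rotated])
        moreover have "x + t *\<^sub>R (y - x) \<in> closure U"
          using lim segk t unfolding closure_sequential by (intro exI[of _ ?z]) auto
        ultimately show ?thesis by (rule closure_pos[rotated])
      qed
      moreover have "(1 - t) *\<^sub>R x + t *\<^sub>R y = x + t *\<^sub>R (y - x)" for t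
        by (simp add: algebra_simps)
      ultimately have "closed_segment x y \<subseteq> U" by (auto simp: in_segment)
      with yU show "y \<in> S" by (auto simp: S_def)
    qed
    moreover have "openin (top_of_set U) S"
      using \<open>open S\<close> by (metis S_def mem_Collect_eq openin_open_eq open_U subsetI)
    moreover have "x \<in> S" using x by (simp add: S_def)
    ultimately have "S = U"
      using connected_U unfolding connected_clopen by blast
    then show ?thesis by (auto simp: S_def)
  qed
  then show ?thesis by (auto simp: convex_contains_segment)
qed

lemma add_mem: "x \<in> U \<Longrightarrow> y \<in> U \<Longrightarrow> x + y \<in> U"
  using cone[of "(1/2) *\<^sub>R x + (1/2) *\<^sub>R y" 2] convexD[OF convex_U, of x y "1/2" "1/2"]
  by (simp add: scaleR_add_right)

lemma add_closure:
  assumes x: "x \<in> U" and y: "y \<in> closure U"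
  shows "x + y \<in> U"
proof -
  obtain e where e: "e > 0" "ball x e \<subseteq> U"
    using open_U x open_contains_ball by blast
  obtain z where z: "z \<in> U" "dist z y < e"
    using y e(1) closure_approachable by blast
  \<comment> \<open>The error \<open>y - z\<close> is absorbed by the ball around the interior point
    \<open>x\<close>.\<close>
  have "x + (y - z) \<in> U"
    using z(2) e(2) by (auto simp: dist_norm norm_minus_commute)
  from add_mem[OF this z(1)] show ?thesis by simp
qed

lemma closure_scale:
  assumes "x \<in> closure U" "r > 0" shows "r *\<^sub>R x \<in> closure U"
proof -
  have "(*\<^sub>R) r ` U \<subseteq> U" using cone assms(2) by auto
  then have "(*\<^sub>R) r ` closure U \<subseteq> closure U"
    unfolding closure_scaleR by (rule closure_mono)
  with assms show ?thesis by auto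
qed

text \<open>For \<open>p\<close> in \<open>U\<close>, a negative value would make the cubic decrease
  initially along the ray \<open>p + t q\<close>, while it finally tends to infinity. It would then
  have a minimum at an inner point of the ray, against \<open>no_interior_min\<close>. The closure
  follows by continuity.\<close>

lemma polar_nonneg:
  assumes p: "p \<in> closure U" and q: "q \<in> U"
  shows "F p p q \<ge> 0"
proof -
  have *: "F p p q \<ge> 0" if p: "p \<in> U" for p
  proof (rule ccontr)
    assume neg: "\<not> F p p q \<ge> 0"
    define g where "g = (\<lambda>t. F (p + t *\<^sub>R q) (p + t *\<^sub>R q) (p + t *\<^sub>R q))"
    have g: "g t = F p p p + 3 * t * F p p q + 3 * t\<^sup>2 * F p q q + t ^ 3 * F q q q" for t
      by (simp add: g_def cube_add_scale)
    have mem: "p + t *\<^sub>R q \<in> U" if "t \<ge> 0" for t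
      using add_mem[OF p cone[OF q, of t]] that p by (cases "t = 0") auto
    have "q \<noteq> 0" using pos[OF q] by auto
    have "(g has_real_derivative 3 * F p p q) (at 0)"
      unfolding g by (auto intro!: derivative_eq_intros)
    then obtain d where d: "d > 0" "\<And>s. 0 < s \<Longrightarrow> s < d \<Longrightarrow> g s < g 0"
      using DERIV_neg_dec_right[of g "3 * F p p q" 0] neg by auto
    have "filterlim g at_top at_top"
    proof -
      \<comment> \<open>The polynomial \<open>g\<close> is assembled in Horner form, starting from
        its positive leading coefficient.\<close>
      have "LIM t at_top. F q q q * t :> at_top"
        by (rule filterlim_tendsto_pos_mult_at_top[OF tendsto_const pos[OF q] filterlim_ident])
      note filterlim_tendsto_add_at_top[OF tendsto_const[of "3 * F p q q"] this]
      note filterlim_at_top_mult_at_top[OF filterlim_ident this]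
      note filterlim_tendsto_add_at_top[OF tendsto_const[of "3 * F p p q"] this]
      note filterlim_at_top_mult_at_top[OF filterlim_ident this]
      note filterlim_tendsto_add_at_top[OF tendsto_const[of "F p p p"] this]
      then show ?thesis
        unfolding g by (simp add: algebra_simps power2_eq_square power3_eq_cube)
    qed
    then obtain R where R: "\<And>t. t \<ge> R \<Longrightarrow> g t \<ge> g 0"
      by (auto simp: filterlim_at_top eventually_at_top_linorder)
    \<comment> \<open>At \<open>M\<close> the value is back above \<open>g 0\<close>, and
      \<open>d / 2\<close> lies in the interval, so neither endpoint can be the minimum.\<close>
    define M where "M = max R d"
    have "continuous_on {0..M} g"
      unfolding g_def by (intro continuous_intros)
    moreover have "M > 0" using d by (simp add: M_def)
    ultimately obtain m where m: "m \<in> {0..M}" "\<And>s. s \<in> {0..M} \<Longrightarrow> g m \<le> g s"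
      using continuous_attains_inf[of "{0..M}" g] by auto
    have "g m \<le> g (d / 2)" using m(2) d by (auto simp: M_def)
    also have "g (d / 2) < g 0" using d by auto
    finally have "g m < g 0" .
    then have "m \<noteq> 0" "\<not> m \<ge> R" using R[of m] by auto
    with m(1) have "0 < min m (M - m)" by (auto simp: M_def)
    then show False
      by (rule no_interior_min[rotated 2])
        (use m mem \<open>q \<noteq> 0\<close> in \<open>auto simp: g_def abs_less_iff\<close>)
  qed
  have "closed {p. F p p q \<ge> 0}"
    by (intro closed_Collect_le continuous_intros)
  then show ?thesis
    using closure_minimal[of U "{p. F p p q \<ge> 0}"] * p by auto
qed

text \<open>A linear functional that is nonnegative on an open set and not identically zero is
  positive there: otherwise a small step against it would make it negative.\<close>

lemma polar_pos:
  assumes p: "p \<in> closure U" and q: "q \<in> U" and w: "F p p w \<noteq> 0"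
  shows "F p p q > 0"
proof -
  have "((\<lambda>t. q - t *\<^sub>R F p p w *\<^sub>R w) \<longlongrightarrow> q - 0 *\<^sub>R F p p w *\<^sub>R w) (at_right 0)"
    by (intro tendsto_intros)
  then have "eventually (\<lambda>t. q - t *\<^sub>R F p p w *\<^sub>R w \<in> U) (at_right 0)"
    by (rule topological_tendstoD) (use open_U q in auto)
  moreover have "eventually (\<lambda>t. t > (0::real)) (at_right 0)"
    by (simp add: eventually_at_right_less)
  ultimately have "eventually (\<lambda>t::real. F p p q > 0) (at_right 0)"
  proof eventually_elim
    case (elim t)
    have "0 \<le> F p p q - t * (F p p w)\<^sup>2"
      using polar_nonneg[OF p elim(1)] by (simp add: diff_simps power2_eq_square)
    moreover have "t * (F p p w)\<^sup>2 > 0" using w elim by simp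
    ultimately show ?case by linarith
  qed
  then show ?thesis by simp
qed

text \<open>Otherwise the whole line \<open>q + t v\<close> lies in \<open>U\<close>. On it the
  cubic term vanishes, leaving a positive polynomial of degree at most two. If its leading
  coefficient is nonnegative, it is either a nonconstant affine function or has a critical point
  forbidden by hyperbolicity; if negative, it cannot stay positive.\<close>

lemma pointed:
  assumes "v \<in> closure U" "- v \<in> closure U"
  shows "v = 0"
proof (rule ccontr)
  assume v: "v \<noteq> 0"
  obtain q where q: "q \<in> U" using nonempty by blast
  have mem: "q + t *\<^sub>R v \<in> U" for t
  proof -
    consider "t = 0" | "t > 0" | "t < 0" by linarith
    then show ?thesis
    proof cases
      case 3
      then have "(- t) *\<^sub>R (- v) \<in> closure U" by (intro closure_scale assms(2)) simp
      from add_closure[OF q this] show ?thesis by simp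
    next
      case 2
      show ?thesis by (rule add_closure[OF q closure_scale[OF assms(1) 2]])
    qed (use q in simp)
  qed
  have vvv: "F v v v = 0"
    using closure_nonneg[OF assms(1)] closure_nonneg[OF assms(2)] by simp
  have quad: "F q q q + 3 * t * F q q v + 3 * t\<^sup>2 * F q v v > 0" for t
    using pos[OF mem[of t]] by (simp add: cube_add_scale vvv)
  \<comment> \<open>The hypothesis says that \<open>t\<close> is a critical point of the quadratic;
    its second-order coefficient is the same at every point of the line.\<close>
  have crit: "F q v v < 0" if "F q q v + 2 * t * F q v v = 0" for t
  proof -
    have "F (q + t *\<^sub>R v) (q + t *\<^sub>R v) v = 0"
      using that vvv swap12[of v q v] by (simp add: add_simps algebra_simps)
    from hyperbolic[OF mem this v] show ?thesis by (simp add: add_simps vvv)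
  qed
  consider "F q v v = 0" | "F q v v > 0" | "F q v v < 0" by linarith
  then show False
  proof cases
    case 1
    then have "F q q v \<noteq> 0" using crit[of 0] by auto
    then show False
      using quad[of "- F q q q / (3 * F q q v)"] 1 by simp
  next
    case 2
    then show False using crit[of "- F q q v / (2 * F q v v)"] by simp
  next
    case 3
    \<comment> \<open>Adding the values at \<open>t\<close> and \<open>- t\<close> cancels the
      linear terms; this \<open>t\<close> makes the sum vanish.\<close>
    define t where "t = sqrt (F q q q / (3 * - F q v v))"
    have "t\<^sup>2 = F q q q / (3 * - F q v v)"
      using 3 pos[OF q] by (simp add: t_def divide_le_0_iff)
    then have "F q q q + 3 * t\<^sup>2 * F q v v = 0"
      using 3 by (simp add: field_simps)
    then show False using quad[of t] quad[of "- t"] by simp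
  qed
qed

end

section \<open>The boundary of the cone: semidefiniteness, kernel and tangent space\<close>

lemma (in symmetric_trilinear) velocity_of_null_curve:
  assumes \<gamma>: "(\<gamma> has_vector_derivative v) (at t)"
    and S: "open S" "t \<in> S" and null: "\<And>s. s \<in> S \<Longrightarrow> F (\<gamma> s) (\<gamma> s) (\<gamma> s) = 0"
  shows "F (\<gamma> t) (\<gamma> t) v = 0"
proof -
  have "((\<lambda>s. F (\<gamma> s) (\<gamma> s) (\<gamma> s)) has_derivative (\<lambda>s. 3 * F (\<gamma> t) (\<gamma> t) (s *\<^sub>R v))) (at t)"
    using diff_chain_at[OF \<gamma>[unfolded has_vector_derivative_def] cube_has_derivative]
    by (simp add: o_def)
  moreover have "((\<lambda>s. F (\<gamma> s) (\<gamma> s) (\<gamma> s)) has_derivative (\<lambda>s. 0)) (at t)"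
    by (rule has_derivative_transform_within_open[OF has_derivative_const S]) (simp add: null)
  ultimately have "(\<lambda>s. 3 * F (\<gamma> t) (\<gamma> t) (s *\<^sub>R v)) = (\<lambda>s. 0)"
    by (rule has_derivative_unique)
  from fun_cong[OF this, of 1] show ?thesis by simp
qed

context hyperbolic_cone
begin

text \<open>Cutting \<open>v\<close> off along \<open>q\<close> moves it into the tangent hyperplane at the interior point
  \<open>p + s q\<close>, where the form is definite; then \<open>s\<close> tends to \<open>0\<close>.\<close>

lemma boundary_semidefinite:
  assumes p: "p \<in> closure U" and w: "F p p w \<noteq> 0" and v: "F p p v = 0"
  shows "F p v v \<le> 0"
proof -
  obtain q where q: "q \<in> U" using nonempty by blast
  have ppq: "F p p q > 0" by (rule polar_pos[OF p q w])
  define x where "x = (\<lambda>s. p + s *\<^sub>R q)"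
  define y where "y = (\<lambda>s. v - (F (x s) (x s) v / F (x s) (x s) q) *\<^sub>R q)"
  have x: "(x \<longlongrightarrow> p) (at_right 0)"
    unfolding x_def by (auto intro!: tendsto_eq_intros)
  have y: "(y \<longlongrightarrow> v - (F p p v / F p p q) *\<^sub>R q) (at_right 0)"
    unfolding y_def by (intro tendsto_intros x) (use ppq in auto)
  have "F (x s) (y s) (y s) \<le> 0" if s: "s > 0" for s
  proof -
    have xU: "x s \<in> U"
      using add_closure[OF cone[OF q s] p] by (simp add: x_def add.commute)
    \<comment> \<open>\<open>x s\<close> itself is the witness that its differential is nonzero, as
      \<open>polar_pos\<close> demands.\<close>
    have "F (x s) (x s) (x s) \<noteq> 0"
      using pos[OF xU] by simp
    then have "F (x s) (x s) q > 0"
      using polar_pos[OF _ q] xU closure_subset by blast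
    then have "F (x s) (x s) (y s) = 0"
      by (simp add: y_def diff_simps)
    with hyperbolic[OF xU this] show ?thesis by (cases "y s = 0") auto
  qed
  then have "eventually (\<lambda>s. F (x s) (y s) (y s) \<le> 0) (at_right 0)"
    using eventually_at_right_less[of "0::real"] by (auto elim: eventually_mono)
  moreover have "((\<lambda>s. F (x s) (y s) (y s)) \<longlongrightarrow> F p v v) (at_right 0)"
    using y by (auto intro!: tendsto x simp: v)
  ultimately show ?thesis
    by (intro tendsto_upperbound) auto
qed

text \<open>Near \<open>p\<close> the cubic increases strictly in the direction \<open>q\<close>.
  From a point with nonnegative cubic, moving along \<open>q\<close> therefore stays in the
  positivity set until it reaches a neighbourhood of \<open>p + d q\<close> inside \<open>U\<close>.
  By \<open>connected_subset\<close> this path lies in \<open>U\<close>, and its starting point is a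
  limit of it.\<close>

lemma locally_superlevel_subset_closure:
  assumes p: "p \<in> closure U" and w: "F p p w \<noteq> 0"
  obtains e where "e > 0" "\<And>x. x \<in> ball p e \<Longrightarrow> F x x x \<ge> 0 \<Longrightarrow> x \<in> closure U"
proof -
  obtain q where q: "q \<in> U" using nonempty by blast
  have "open {y. F y y q > 0}"
    by (intro open_Collect_less continuous_intros)
  moreover have "p \<in> {y. F y y q > 0}" using polar_pos[OF p q w] by simp
  ultimately obtain r where r: "r > 0" "ball p r \<subseteq> {y. F y y q > 0}"
    using open_contains_ball by blast
  have "q \<noteq> 0" using pos[OF q] by auto
  \<comment> \<open>Chosen so that a path of length \<open>d * norm q = r / 2\<close>, starting
    within \<open>r / 2\<close> of \<open>p\<close>, stays in the ball of radius
    \<open>r\<close>.\<close>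
  define d where "d = r / (2 * norm q)"
  have d: "d > 0" using r(1) \<open>q \<noteq> 0\<close> by (simp add: d_def)
  have "p + d *\<^sub>R q \<in> U"
    using add_closure[OF cone[OF q d] p] by (simp add: add.commute)
  then obtain e where e: "e > 0" "ball (p + d *\<^sub>R q) e \<subseteq> U"
    using open_U open_contains_ball by blast
  have "x \<in> closure U" if x: "x \<in> ball p (min e (r / 2))" and nonneg: "F x x x \<ge> 0" for x
  proof -
    define g where "g = (\<lambda>s. F (x + s *\<^sub>R q) (x + s *\<^sub>R q) (x + s *\<^sub>R q))"
    \<comment> \<open>The parameter \<open>0\<close> is left out because the cubic may vanish at
      \<open>x\<close>.\<close>
    define S where "S = (\<lambda>s. x + s *\<^sub>R q) ` {0<..d}"
    have deriv: "(g has_real_derivative 3 * F (x + s *\<^sub>R q) (x + s *\<^sub>R q) q) (at s)" for s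
    proof -
      have "((\<lambda>s. x + s *\<^sub>R q) has_derivative (\<lambda>s. s *\<^sub>R q)) (at s)"
        by (auto intro!: derivative_eq_intros)
      from diff_chain_at[OF this cube_has_derivative]
      have "(g has_derivative (\<lambda>r. 3 * F (x + s *\<^sub>R q) (x + s *\<^sub>R q) (r *\<^sub>R q))) (at s)"
        by (simp add: g_def o_def)
      then show ?thesis
        by (rule has_derivative_imp_has_field_derivative) simp
    qed
    have *: "F (x + s *\<^sub>R q) (x + s *\<^sub>R q) q > 0" if s: "0 \<le> s" "s \<le> d" for s
    proof -
      have "dist p (x + s *\<^sub>R q) \<le> dist p x + s * norm q"
        using dist_triangle[of p "x + s *\<^sub>R q" x] s by (simp add: dist_norm)
      also have "s * norm q \<le> d * norm q" using s by (simp add: mult_right_mono)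
      also have "d * norm q = r / 2" using \<open>q \<noteq> 0\<close> by (simp add: d_def)
      finally have "x + s *\<^sub>R q \<in> ball p r" using x by simp
      with r(2) show ?thesis by blast
    qed
    have incr: "g 0 < g s" if "0 < s" "s \<le> d" for s
    proof (rule DERIV_pos_imp_increasing[OF that(1)])
      fix r assume "0 \<le> r" "r \<le> s"
      with \<open>s \<le> d\<close> deriv[of r] * show "\<exists>y. (g has_real_derivative y) (at r) \<and> 0 < y"
        by (intro exI[of _ "3 * F (x + r *\<^sub>R q) (x + r *\<^sub>R q) q"]) simp
    qed
    have "connected S"
      unfolding S_def by (intro connected_continuous_image continuous_intros) simp
    moreover have "F z z z > 0" if "z \<in> S" for z
      using that incr nonneg by (force simp: S_def g_def)
    moreover have "x + d *\<^sub>R q \<in> S" using d by (auto simp: S_def)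
    moreover have "x + d *\<^sub>R q \<in> U"
      using e(2) x by (auto simp: dist_norm)
    ultimately have "S \<subseteq> U" by (rule connected_subset)
    have "eventually (\<lambda>s. x + s *\<^sub>R q \<in> closure U) (at_right 0)"
      using eventually_at_right_real[OF d]
    proof eventually_elim
      case (elim s)
      then have "x + s *\<^sub>R q \<in> S" by (auto simp: S_def)
      with \<open>S \<subseteq> U\<close> closure_subset show ?case by blast
    qed
    moreover have "((\<lambda>s. x + s *\<^sub>R q) \<longlongrightarrow> x) (at_right 0)"
      by (auto intro!: tendsto_eq_intros)
    ultimately show ?thesis
      by (intro Lim_in_closed_set[of "closure U"]) auto
  qed
  with e(1) r(1) that[of "min e (r / 2)"] show thesis by auto
qed

text \<open>If \<open>F u u u\<close> were nonzero, a point of the line \<open>p + t u\<close> would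
  lie in \<open>U\<close>, but \<open>F p p\<close> vanishes on this line, against
  \<open>polar_pos\<close>. So the cubic vanishes on the line, and the parameters staying in
  \<open>closure U\<close> form a clopen set. Hence the whole line lies in the closure, which
  \<open>pointed\<close> excludes.\<close>

lemma boundary_kernel_trivial:
  assumes p: "p \<in> closure U" "p \<noteq> 0" "F p p p = 0"
    and regular: "\<And>y. y \<in> frontier U - {0} \<Longrightarrow> \<exists>w. F y y w \<noteq> 0"
    and u: "\<And>w. F p u w = 0"
  shows "u = 0"
proof (rule ccontr)
  assume "u \<noteq> 0"
  obtain q where q: "q \<in> U" using nonempty by blast
  obtain w where w: "F p p w \<noteq> 0"
    using regular[of p] p frontier_iff by blast
  have ppu: "F p p u = 0" using u[of p] swap23[of p p u] by simp
  have cube: "F (p + t *\<^sub>R u) (p + t *\<^sub>R u) (p + t *\<^sub>R u) = t ^ 3 * F u u u" for t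
    using u p(3) ppu by (simp add: cube_add_scale)
  have uuu: "F u u u = 0"
  proof (rule ccontr)
    assume uuu: "F u u u \<noteq> 0"
    obtain e where e: "e > 0" "\<And>x. x \<in> ball p e \<Longrightarrow> F x x x \<ge> 0 \<Longrightarrow> x \<in> closure U"
      using locally_superlevel_subset_closure[OF p(1) w] by blast
    \<comment> \<open>The sign makes the cubic positive at \<open>x\<close>; the size keeps
      \<open>x\<close> within \<open>e\<close> of \<open>p\<close>.\<close>
    define t where "t = sgn (F u u u) * (e / (2 * norm u))"
    define x where "x = p + t *\<^sub>R u"
    have "\<bar>t\<bar> * norm u = e / 2"
      using \<open>u \<noteq> 0\<close> e(1) uuu by (simp add: t_def abs_mult abs_sgn_eq)
    then have "x \<in> ball p e"
      using e(1) by (simp add: x_def dist_norm)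
    moreover have "F x x x > 0"
    proof -
      have "t ^ 3 * F u u u = (e / (2 * norm u)) ^ 3 * (sgn (F u u u) ^ 3 * F u u u)"
        unfolding t_def power_mult_distrib by simp
      also have "sgn (F u u u) ^ 3 * F u u u = \<bar>F u u u\<bar>"
        by (auto simp: sgn_if)
      finally show ?thesis
        using e(1) uuu \<open>u \<noteq> 0\<close> by (simp add: x_def cube)
    qed
    ultimately have "x \<in> U" using e(2) closure_pos by force
    from polar_pos[OF p(1) this w] show False
      by (simp add: x_def add_simps p(3) ppu)
  qed
  define A where "A = {t. p + t *\<^sub>R u \<in> closure U}"
  have "closed A"
  proof -
    have "A = (\<lambda>t. p + t *\<^sub>R u) -` closure U" by (auto simp: A_def)
    then show ?thesis
      by (auto intro!: closed_vimage continuous_intros)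
  qed
  moreover have "open A"
    unfolding open_subopen[of A]
  proof
    fix t assume "t \<in> A"
    define y where "y = p + t *\<^sub>R u"
    have y: "y \<in> closure U" using \<open>t \<in> A\<close> by (simp add: A_def y_def)
    have "y \<noteq> 0"
    proof
      assume "y = 0"
      then have "p = - t *\<^sub>R u" by (simp add: y_def add_eq_0_iff2)
      then have "F p p w = - t * F p u w" by (metis scale_simps(2))
      with u w show False by simp
    qed
    moreover have "y \<in> frontier U"
      using y cube uuu by (simp add: frontier_iff y_def)
    ultimately obtain w' where "F y y w' \<noteq> 0" using regular by blast
    from locally_superlevel_subset_closure[OF y this]
    obtain e where e: "e > 0" "\<And>x. x \<in> ball y e \<Longrightarrow> F x x x \<ge> 0 \<Longrightarrow> x \<in> closure U"
      by blast
    have "open ((\<lambda>s. p + s *\<^sub>R u) -` ball y e)"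
      by (intro open_vimage continuous_intros) simp
    moreover have "t \<in> (\<lambda>s. p + s *\<^sub>R u) -` ball y e" using e(1) by (simp add: y_def)
    moreover have "(\<lambda>s. p + s *\<^sub>R u) -` ball y e \<subseteq> A"
      using e(2) cube uuu by (auto simp: A_def)
    ultimately show "\<exists>T. open T \<and> t \<in> T \<and> T \<subseteq> A" by blast
  qed
  moreover have "0 \<in> A" using p(1) by (simp add: A_def)
  ultimately have "A = UNIV" using clopen[of A] by auto
  then have line: "p + t *\<^sub>R u \<in> closure U" for t by (auto simp: A_def)
  \<comment> \<open>Shrinking the line towards the origin retains only its direction.\<close>
  have "s *\<^sub>R u \<in> closure U" for s
  proof -
    have "eventually (\<lambda>r. r *\<^sub>R p + s *\<^sub>R u \<in> closure U) (at_right 0)"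
      using eventually_at_right_less[of "0::real"]
    proof eventually_elim
      case (elim r)
      have "r *\<^sub>R p + s *\<^sub>R u = r *\<^sub>R (p + (s / r) *\<^sub>R u)"
        using elim by (simp add: scaleR_add_right)
      then show ?case using closure_scale[OF line elim] by simp
    qed
    moreover have "((\<lambda>r. r *\<^sub>R p + s *\<^sub>R u) \<longlongrightarrow> s *\<^sub>R u) (at_right 0)"
      by (auto intro!: tendsto_eq_intros)
    ultimately show ?thesis
      by (intro Lim_in_closed_set[of "closure U"]) auto
  qed
  from this[of 1] this[of "-1"] pointed[of u] \<open>u \<noteq> 0\<close> show False by simp
qed

text \<open>Every vector is the sum of one in the kernel of \<open>F p p\<close> and a multiple of
  \<open>q\<close>. On the first both \<open>F p v\<close> and \<open>F p p\<close> vanish, and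
  \<open>c\<close> is chosen to cancel the value at \<open>q\<close>; so
  \<open>boundary_kernel_trivial\<close> applies to \<open>v - c p\<close>.\<close>

lemma boundary_kernel:
  assumes p: "p \<in> frontier U - {0}"
    and regular: "\<And>y. y \<in> frontier U - {0} \<Longrightarrow> \<exists>w. F y y w \<noteq> 0"
    and v: "F p p v = 0" "\<And>w. F p p w = 0 \<Longrightarrow> F p v w = 0"
  shows "v \<in> span {p}"
proof -
  obtain q where q: "q \<in> U" using nonempty by blast
  have p': "p \<in> closure U" "p \<noteq> 0" "F p p p = 0"
    using p frontier_iff by auto
  obtain w where "F p p w \<noteq> 0" using regular p by blast
  then have ppq: "F p p q > 0" using polar_pos p' q by blast
  define c where "c = F p v q / F p p q"
  have "F p (v - c *\<^sub>R p) w = 0" for w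
  proof -
    define w' where "w' = w - (F p p w / F p p q) *\<^sub>R q"
    have "F p p w' = 0" using ppq by (simp add: w'_def diff_simps)
    from v(2)[OF this] show ?thesis
      using ppq by (simp add: w'_def c_def diff_simps)
  qed
  from boundary_kernel_trivial[OF p' regular this] show ?thesis
    by (auto simp: span_singleton)
qed

text \<open>The curves are found by applying the inverse function theorem to a map \<open>f\<close> with
  \<open>f p = p\<close> and derivative the identity at \<open>p\<close> for which the linear functional \<open>3 F p p\<close> of \<open>f y\<close>
  is the cubic at \<open>y\<close>: the inverse of \<open>f\<close> sends the tangent hyperplane into the boundary.\<close>

lemma tangent_space_boundary:
  assumes p: "p \<in> frontier U - {0}" and w: "F p p w \<noteq> 0"
  shows "tangent_space (frontier U - {0}) p = {v. F p p v = 0}"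
proof (intro equalityI subsetI)
  fix v assume "v \<in> tangent_space (frontier U - {0}) p"
  then obtain \<gamma> e where \<gamma>: "e > 0" "\<gamma> ` {-e<..<e} \<subseteq> frontier U - {0}" "\<gamma> 0 = p"
    "(\<gamma> has_vector_derivative v) (at 0)"
    unfolding tangent_space_def by blast
  have "F (\<gamma> 0) (\<gamma> 0) v = 0"
    by (rule velocity_of_null_curve[OF \<gamma>(4), of "{-e<..<e}"])
      (use \<gamma> frontier_iff in \<open>auto simp: image_subset_iff\<close>)
  then show "v \<in> {v. F p p v = 0}" using \<gamma>(3) by simp
next
  fix v assume "v \<in> {v. F p p v = 0}"
  then have v: "F p p v = 0" by simp
  obtain q where q: "q \<in> U" using nonempty by blast
  have p': "p \<in> closure U" "p \<noteq> 0" "F p p p = 0"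
    using p frontier_iff by auto
  define c where "c = F p p q"
  have c: "c > 0" unfolding c_def by (rule polar_pos[OF p'(1) q w])
  obtain e where e: "e > 0" "\<And>x. x \<in> ball p e \<Longrightarrow> F x x x \<ge> 0 \<Longrightarrow> x \<in> closure U"
    using locally_superlevel_subset_closure[OF p'(1) w] by blast
  \<comment> \<open>The three conditions serve, in order, to divide by \<open>F y y q\<close>, to
    place null points in \<open>closure U\<close>, and to avoid the apex.\<close>
  define W where "W = {y. F y y q > 0} \<inter> ball p e \<inter> - {0}"
  have "open W"
    unfolding W_def by (intro open_Int open_Collect_less continuous_intros) auto
  have "p \<in> W" using c p' e(1) by (simp add: W_def c_def)
  define f where "f = (\<lambda>y. y + ((F y y y - 3 * F p p y) / (3 * c)) *\<^sub>R q)"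
  define f' where "f' = (\<lambda>y. Blinfun (\<lambda>v. v + ((F y y v - F p p v) / c) *\<^sub>R q))"
  have "linear (\<lambda>v. v + ((F y y v - F p p v) / c) *\<^sub>R q)" for y
    by (intro linearI) (simp_all add: add_simps algebra_simps add_divide_distrib diff_divide_distrib)
  then have f'_apply [simp]: "blinfun_apply (f' y) v = v + ((F y y v - F p p v) / c) *\<^sub>R q" for y v
    unfolding f'_def by (subst bounded_linear_Blinfun_apply) (simp_all add: linear_conv_bounded_linear)
  have "(f has_derivative f' y) (at y)" for y
  proof -
    have lin: "((\<lambda>y. F p p y) has_derivative F p p) (at y)"
      by (rule bounded_linear_imp_has_derivative[OF linear3[unfolded linear_conv_bounded_linear]])
    have "(f has_derivative (\<lambda>v. v + ((3 * F y y v - 3 * F p p v) / (3 * c)) *\<^sub>R q)) (at y)"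
      unfolding f_def
      by (rule lin cube_has_derivative derivative_eq_intros refl | use c in simp)+
    moreover have "(3 * a - 3 * b) / (3 * c) = (a - b) / c" for a b
      using c by (simp add: field_simps)
    ultimately show ?thesis by (simp flip: f'_apply)
  qed
  moreover have "continuous_on W f'"
    by (intro continuous_on_blinfun_componentwise) (use c in \<open>auto intro!: continuous_intros\<close>)
  moreover have "id_blinfun o\<^sub>L f' p = id_blinfun"
    by (intro blinfun_eqI) simp
  ultimately obtain U' V g g' where inv: "open U'" "U' \<subseteq> W" "p \<in> U'" "open V" "f p \<in> V"
    "homeomorphism U' V f g"
    "\<And>y. y \<in> V \<Longrightarrow> (g has_derivative g' y) (at y)"
    "\<And>y. y \<in> V \<Longrightarrow> g' y = inv (blinfun_apply (f' (g y)))"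
    "\<And>y. y \<in> V \<Longrightarrow> bij (blinfun_apply (f' (g y)))"
    using inverse_function_theorem[OF \<open>open W\<close> _ _ \<open>p \<in> W\<close>] by metis
  have fp: "f p = p" by (simp add: f_def p'(3))
  have "open ((\<lambda>t. p + t *\<^sub>R v) -` V)"
    using inv(4) by (intro open_vimage continuous_intros)
  moreover have "0 \<in> (\<lambda>t. p + t *\<^sub>R v) -` V" using inv(5) fp by simp
  ultimately obtain d where d: "d > 0" "ball 0 d \<subseteq> (\<lambda>t. p + t *\<^sub>R v) -` V"
    using open_contains_ball by blast
  define I where "I = {-d<..<d}"
  have V: "p + t *\<^sub>R v \<in> V" if "t \<in> I" for t
    using that d(2) by (auto simp: I_def dist_real_def subset_iff)
  define \<gamma> where "\<gamma> = (\<lambda>t. g (p + t *\<^sub>R v))"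
  define D where "D = (\<lambda>t. g' (p + t *\<^sub>R v) v)"
  have \<gamma>W: "\<gamma> t \<in> W" and f\<gamma>: "f (\<gamma> t) = p + t *\<^sub>R v" if "t \<in> I" for t
    using V[OF that] inv(2,6) unfolding homeomorphism_def \<gamma>_def by auto
  have null: "F (\<gamma> t) (\<gamma> t) (\<gamma> t) = 0" if "t \<in> I" for t
  proof -
    have "F p p (f (\<gamma> t)) = F (\<gamma> t) (\<gamma> t) (\<gamma> t) / 3"
      using c by (simp add: f_def add_simps c_def[symmetric] field_simps)
    then show ?thesis by (simp add: f\<gamma>[OF that] add_simps v p'(3))
  qed
  have \<gamma>_deriv: "(\<gamma> has_vector_derivative D t) (at t)" if "t \<in> I" for t
  proof -
    have "((\<lambda>t. p + t *\<^sub>R v) has_derivative (\<lambda>s. s *\<^sub>R v)) (at t)"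
      by (auto intro!: derivative_eq_intros)
    from diff_chain_at[OF this inv(7)[OF V[OF that]]]
    have "(\<gamma> has_derivative (\<lambda>s. g' (p + t *\<^sub>R v) (s *\<^sub>R v))) (at t)"
      by (simp add: o_def \<gamma>_def)
    moreover have "g' (p + t *\<^sub>R v) (s *\<^sub>R v) = s *\<^sub>R D t" for s
      unfolding D_def
      by (rule linear_scale[OF has_derivative_linear[OF inv(7)[OF V[OF that]]]])
    ultimately show ?thesis by (simp add: has_vector_derivative_def)
  qed
  \<comment> \<open>This formula yields continuity of the velocity. The derivative of
    \<open>f\<close> changes vectors only by multiples of \<open>q\<close>, so \<open>D t\<close> is
    \<open>v\<close> plus such a multiple, and vanishing of the cubic along the curve determines the
    factor.\<close>
  have D: "D t = v - (F (\<gamma> t) (\<gamma> t) v / F (\<gamma> t) (\<gamma> t) q) *\<^sub>R q" if t: "t \<in> I" for t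
  proof -
    have "f' (\<gamma> t) (D t) = v"
      using inv(8,9)[OF V[OF t]] by (simp add: D_def \<gamma>_def bij_is_surj surj_f_inv_f del: f'_apply)
    then obtain \<mu> where \<mu>: "D t = v + \<mu> *\<^sub>R q"
      by (metis f'_apply add_diff_cancel_right' diff_conv_add_uminus scaleR_minus_left)
    have "F (\<gamma> t) (\<gamma> t) (D t) = 0"
      by (rule velocity_of_null_curve[OF \<gamma>_deriv[OF t], of I]) (use t null in \<open>auto simp: I_def\<close>)
    moreover have "F (\<gamma> t) (\<gamma> t) q \<noteq> 0" using \<gamma>W[OF t] by (simp add: W_def)
    ultimately have "\<mu> = - (F (\<gamma> t) (\<gamma> t) v / F (\<gamma> t) (\<gamma> t) q)"
      by (simp add: \<mu> add_simps field_simps add_eq_0_iff)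
    with \<mu> show ?thesis by simp
  qed
  have "continuous_on I \<gamma>"
    using \<gamma>_deriv by (meson continuous_at_imp_continuous_on has_vector_derivative_continuous)
  then have "continuous_on I (\<lambda>t. v - (F (\<gamma> t) (\<gamma> t) v / F (\<gamma> t) (\<gamma> t) q) *\<^sub>R q)"
    by (intro continuous_intros) (use \<gamma>W in \<open>force simp: W_def\<close>)+
  then have "continuous_on I D"
    using D by (simp cong: continuous_on_cong)
  with \<gamma>_deriv have "\<gamma> C1_differentiable_on I"
    unfolding C1_differentiable_on_def by blast
  moreover have "\<gamma> ` I \<subseteq> frontier U - {0}"
    using null \<gamma>W e(2) by (auto simp: frontier_iff W_def)
  moreover have "\<gamma> 0 = p"
    using inv(3,6) fp unfolding homeomorphism_def \<gamma>_def by force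
  moreover have "0 \<in> I" using d(1) by (simp add: I_def)
  then have "(\<gamma> has_vector_derivative v) (at 0)"
    using \<gamma>_deriv[of 0] D[of 0] \<open>\<gamma> 0 = p\<close> v by simp
  ultimately show "v \<in> tangent_space (frontier U - {0}) p"
    unfolding tangent_space_def I_def using d(1) by blast
qed

end

section \<open>From the signature condition on a CCPSR manifold to a hyperbolic cone\<close>

text \<open>The span of the positive vectors of the orthogonal basis is a positive definite hyperplane.
  It contains a combination of \<open>x\<close> and \<open>v\<close> on which the form would be nonpositive.\<close>

lemma lorentzian_orthogonal_complement:
  fixes B :: "'a::euclidean_space \<Rightarrow> 'a \<Rightarrow> real"
  assumes lin: "\<And>u. linear (B u)" and sym: "\<And>u v. B u v = B v u"
    and sig: "has_signature B n 1" and dim: "DIM('a) = n + 1"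
    and x: "B x x < 0" and v: "B x v = 0" "v \<noteq> 0"
  shows "B v v > 0"
proof (rule ccontr)
  assume "\<not> B v v > 0"
  then have vv: "B v v \<le> 0" by simp
  have lin': "linear (\<lambda>u. B u v)" for v
    using lin[of v] by (simp add: sym[of _ v])
  note B_simps = linear_diff[OF lin] linear_diff[OF lin'] linear_scale[OF lin] linear_scale[OF lin']
  obtain E where E: "independent E" "span E = UNIV"
    and orth: "\<And>u v. u \<in> E \<Longrightarrow> v \<in> E \<Longrightarrow> u \<noteq> v \<Longrightarrow> B u v = 0"
    and card_pos: "card {v \<in> E. B v v > 0} = n" and card_neg: "card {v \<in> E. B v v < 0} = 1"
    using sig unfolding has_signature_def by blast
  have fin: "finite E" using E(1) independent_imp_finite by blast
  have "card E = n + 1"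
    using E dim_span[of E] dim_eq_card_independent[OF E(1)] dim by (simp add: dim_UNIV)
  moreover obtain e0 where e0: "{v \<in> E. B v v < 0} = {e0}"
    using card_neg card_1_singletonE by blast
  \<comment> \<open>The \<open>n\<close> positive and the one negative vector already exhaust the
    basis, so no basis vector is null.\<close>
  moreover have "card ({v \<in> E. B v v > 0} \<union> {v \<in> E. B v v < 0}) = n + 1"
    using fin by (subst card_Un_disjoint) (auto simp: card_pos card_neg)
  ultimately have "{v \<in> E. B v v > 0} \<union> {v \<in> E. B v v < 0} = E"
    using fin by (intro card_subset_eq) auto
  with e0 have pos: "B e e > 0" if "e \<in> E - {e0}" for e using that by blast
  have "e0 \<in> E" using e0 by blast
  have definite: "B w w > 0" if w: "w \<in> span (E - {e0})" "w \<noteq> 0" for w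
  proof -
    obtain c where c: "w = (\<Sum>e\<in>E - {e0}. c e *\<^sub>R e)"
      using w(1) fin by (auto simp: span_finite)
    have "B w w = (\<Sum>e\<in>E - {e0}. \<Sum>e'\<in>E - {e0}. c e * (c e' * B e e'))"
      unfolding c linear_sum[OF lin] linear_sum[OF lin'] B_simps
      by (simp add: sum_distrib_left sym mult.left_commute)
    also have "\<dots> = (\<Sum>e\<in>E - {e0}. (c e)\<^sup>2 * B e e)"
    proof (rule sum.cong[OF refl])
      fix e assume e: "e \<in> E - {e0}"
      have "(\<Sum>e'\<in>E - {e0}. c e * (c e' * B e e')) =
          (\<Sum>e'\<in>E - {e0}. if e' = e then (c e)\<^sup>2 * B e e else 0)"
        using e orth by (intro sum.cong) (auto simp: power2_eq_square)
      also have "\<dots> = (c e)\<^sup>2 * B e e" using e fin by (simp add: sum.delta)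
      finally show "(\<Sum>e'\<in>E - {e0}. c e * (c e' * B e e')) = (c e)\<^sup>2 * B e e" .
    qed
    also have "\<dots> > 0"
    proof -
      obtain e where e: "e \<in> E - {e0}" "c e \<noteq> 0"
        using c w(2) sum.neutral[of "E - {e0}" "\<lambda>e. c e *\<^sub>R e"] by force
      show ?thesis
        by (rule sum_pos2[OF _ e(1)]) (use fin e pos in \<open>auto simp: less_imp_le\<close>)
    qed
    finally show ?thesis .
  qed
  have "z \<in> span (insert e0 (E - {e0}))" for z
    using E(2) \<open>e0 \<in> E\<close> by (simp add: insert_absorb)
  then obtain a b where a: "x - a *\<^sub>R e0 \<in> span (E - {e0})" and b: "v - b *\<^sub>R e0 \<in> span (E - {e0})"
    unfolding span_insert by blast
  have "a \<noteq> 0"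
  proof
    assume "a = 0"
    with a have "x \<in> span (E - {e0})" by simp
    with definite[of x] x linear_0[OF lin] show False by force
  qed
  \<comment> \<open>The \<open>e0\<close> components cancel, so \<open>w\<close> lies in the
    definite hyperplane; \<open>B x v = 0\<close> removes the mixed terms from
    \<open>B w w\<close>.\<close>
  define w where "w = a *\<^sub>R v - b *\<^sub>R x"
  have "w = a *\<^sub>R (v - b *\<^sub>R e0) - b *\<^sub>R (x - a *\<^sub>R e0)"
    by (simp add: w_def algebra_simps)
  with a b have "w \<in> span (E - {e0})" by (metis span_diff span_scale)
  moreover have Bw: "B w w = a\<^sup>2 * B v v + b\<^sup>2 * B x x"
    using v(1) sym[of v x] by (simp add: w_def B_simps power2_eq_square)
  have "a\<^sup>2 * B v v \<le> 0" "b\<^sup>2 * B x x \<le> 0"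
    using vv x by (simp_all add: mult_nonneg_nonpos)
  with Bw have "B w w \<le> 0" by simp
  ultimately have "w = 0" using definite by force
  then have "B w w = 0" using linear_0[OF lin] by simp
  with Bw \<open>a\<^sup>2 * B v v \<le> 0\<close> \<open>b\<^sup>2 * B x x \<le> 0\<close> have "b\<^sup>2 * B x x = 0" by linarith
  with x have "b = 0" by simp
  with \<open>w = 0\<close> \<open>a \<noteq> 0\<close> v(2) show False by (simp add: w_def)
qed

text \<open>Averaging the trilinear form given by the coefficients over the six permutations makes
  it symmetric and leaves its diagonal unchanged.\<close>

lemma homogeneous_cubic_polar_form:
  fixes h :: "real ^ 'm \<Rightarrow> real"
  assumes "homogeneous_cubic h"
  obtains F where "symmetric_trilinear F" "h = (\<lambda>x. F x x x)"
proof -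
  obtain a where a: "\<And>x. h x = (\<Sum>i\<in>UNIV. \<Sum>j\<in>UNIV. \<Sum>k\<in>UNIV. a i j k * x $ i * x $ j * x $ k)"
    using assms unfolding homogeneous_cubic_def by blast
  define G where "G = (\<lambda>x y z :: real ^ 'm.
    \<Sum>i\<in>UNIV. \<Sum>j\<in>UNIV. \<Sum>k\<in>UNIV. a i j k * x $ i * y $ j * z $ k)"
  define F where "F = (\<lambda>x y z. (G x y z + G x z y + G y x z + G y z x + G z x y + G z y x) / 6)"
  have G_add: "G (x + x') y z = G x y z + G x' y z" "G x (y + y') z = G x y z + G x y' z"
    "G x y (z + z') = G x y z + G x y z'" for x x' y y' z z'
    by (simp_all add: G_def algebra_simps sum.distrib)
  have G_scale: "G (r *\<^sub>R x) y z = r * G x y z" "G x (r *\<^sub>R y) z = r * G x y z"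
    "G x y (r *\<^sub>R z) = r * G x y z" for r x y z
    by (simp_all add: G_def sum_distrib_left mult.assoc mult.left_commute)
  have "symmetric_trilinear F"
    by unfold_locales (auto simp: F_def G_add G_scale algebra_simps add_divide_distrib intro!: linearI)
  moreover have "h = (\<lambda>x. F x x x)"
    by (simp add: fun_eq_iff F_def a G_def)
  ultimately show thesis by (rule that)
qed

text \<open>The cone is the preimage of the clopen subset \<open>H\<close> of the level set under the radial
  projection.\<close>

lemma (in symmetric_trilinear) hyperbolic_cone_over:
  assumes H: "H \<noteq> {}" "openin (top_of_set {x. F x x x = 1}) H" "connected H" "closed H"
    and hyperbolic: "\<And>x v. x \<in> H \<Longrightarrow> F x x v = 0 \<Longrightarrow> v \<noteq> 0 \<Longrightarrow> F x v v < 0"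
  shows "hyperbolic_cone F (cone_over H)"
proof -
  define P where "P = {x. F x x x > 0}"
  define \<rho> where "\<rho> = (\<lambda>x. inverse (root 3 (F x x x)) *\<^sub>R x)"
  have sub: "F x x x = 1" if "x \<in> H" for x
    using openin_imp_subset[OF H(2)] that by auto
  have "open P"
    unfolding P_def by (intro open_Collect_less continuous_intros)
  have cont: "continuous_on P \<rho>"
    unfolding \<rho>_def P_def by (intro continuous_intros) auto
  have image: "\<rho> ` P \<subseteq> {x. F x x x = 1}"
  proof clarify
    fix x assume "x \<in> P"
    then have "F x x x > 0" by (simp add: P_def)
    then have "root 3 (F x x x) ^ 3 = F x x x" "root 3 (F x x x) \<noteq> 0" by auto
    then show "F (\<rho> x) (\<rho> x) (\<rho> x) = 1"
      by (simp add: \<rho>_def power3_eq_cube field_simps)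
  qed
  have cone_eq: "cone_over H = P \<inter> \<rho> -` H"
  proof (intro equalityI subsetI)
    fix x assume "x \<in> cone_over H"
    then obtain r y where x: "x = r *\<^sub>R y" "r > 0" "y \<in> H" by (auto simp: cone_over_def)
    have "F x x x = r ^ 3" using x sub by (simp add: power3_eq_cube)
    moreover from this have "root 3 (F x x x) = r"
      using x by (simp add: real_root_power_cancel)
    ultimately show "x \<in> P \<inter> \<rho> -` H"
      using x by (simp add: P_def \<rho>_def)
  next
    fix x assume x: "x \<in> P \<inter> \<rho> -` H"
    then have "root 3 (F x x x) > 0" by (simp add: P_def)
    then have "x = root 3 (F x x x) *\<^sub>R \<rho> x" by (simp add: \<rho>_def)
    with x \<open>root 3 (F x x x) > 0\<close> show "x \<in> cone_over H"
      unfolding cone_over_def by blast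
  qed
  show ?thesis
  proof unfold_locales
    have "openin (top_of_set P) (P \<inter> \<rho> -` H)"
      using cont H(2) image by (auto simp: continuous_on_open_gen image_subset_iff_funcset)
    then show "open (cone_over H)"
      using \<open>open P\<close> by (metis cone_eq openin_open_trans)
    have "cone_over H = (\<lambda>(r, x). r *\<^sub>R x) ` ({0<..} \<times> H)"
      by (auto simp: cone_over_def)
    moreover have "connected ((\<lambda>(r::real, x). r *\<^sub>R x) ` ({0<..} \<times> H))"
      unfolding split_beta
      by (intro connected_continuous_image connected_Times H continuous_intros) simp
    ultimately show "connected (cone_over H)" by simp
    obtain y where "y \<in> H" using H(1) by blast
    then have "1 *\<^sub>R y \<in> cone_over H" unfolding cone_over_def by (blast intro: zero_less_one)
    then show "cone_over H \<noteq> {}" by blast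
    show "r *\<^sub>R x \<in> cone_over H" if "x \<in> cone_over H" "r > 0" for x r
      using that by (force simp: cone_over_def)
    show "F x x x > 0" if "x \<in> cone_over H" for x
      using that by (simp add: cone_eq P_def)
    \<comment> \<open>Where the cubic is positive the radial projection is continuous, so closedness
      of \<open>H\<close> passes to the cone there.\<close>
    show "x \<in> cone_over H" if x: "x \<in> closure (cone_over H)" "F x x x > 0" for x
    proof -
      obtain f where f: "\<And>k. f k \<in> cone_over H" "f \<longlonglongrightarrow> x"
        using x(1) unfolding closure_sequential by blast
      have "x \<in> P" using x(2) by (simp add: P_def)
      with cont \<open>open P\<close> have "isCont \<rho> x"
        by (simp add: continuous_on_eq_continuous_at)
      then have lim: "(\<lambda>k. \<rho> (f k)) \<longlonglongrightarrow> \<rho> x"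
        using f(2) by (rule isCont_tendsto_compose)
      have "\<rho> (f k) \<in> H" for k
        using f(1)[of k] cone_eq by blast
      then have "\<rho> x \<in> H"
        by (rule closed_sequentially[OF H(4) _ lim])
      with \<open>x \<in> P\<close> show ?thesis by (simp add: cone_eq)
    qed
    show "F x v v < 0" if x: "x \<in> cone_over H" and v: "F x x v = 0" "v \<noteq> 0" for x v
    proof -
      obtain r y where "x = r *\<^sub>R y" "r > 0" "y \<in> H"
        using x by (auto simp: cone_over_def)
      with v hyperbolic[of y v] show ?thesis by (simp add: mult_pos_neg)
    qed
  qed
qed

text \<open>For the negated Hessian at \<open>x\<close>, the vector \<open>x\<close> is itself a
  negative direction and its orthogonal complement is the kernel of \<open>F x x\<close>. So
  \<open>lorentzian_orthogonal_complement\<close> turns the signature into definiteness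
  there.\<close>

lemma CCPSR_manifold_hyperbolic_cone:
  fixes h :: "real ^ 'm \<Rightarrow> real"
  assumes "CCPSR_manifold n h H"
  obtains F where "h = (\<lambda>x. F x x x)" "hyperbolic_cone F (cone_over H)"
proof -
  note M = assms[unfolded CCPSR_manifold_def]
  obtain F where F: "symmetric_trilinear F" and h: "h = (\<lambda>x. F x x x)"
    using M homogeneous_cubic_polar_form by blast
  interpret symmetric_trilinear F by (rule F)
  have "F x v v < 0" if x: "x \<in> H" and v: "F x x v = 0" "v \<noteq> 0" for x v
  proof -
    have "hyperbolic_point n h x" using M x by blast
    then have sig: "has_signature (\<lambda>u v. - (6 * F x u v)) n 1" and pos: "F x x x > 0"
      unfolding hyperbolic_point_def h hessian_cube by auto
    have "0 < - (6 * F x v v)"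
    proof (rule lorentzian_orthogonal_complement[OF _ _ sig, of x])
      show "linear (\<lambda>v. - (6 * F x u v))" for u
        by (intro linearI) (simp_all add: add_simps)
      show "- (6 * F x u v) = - (6 * F x v u)" for u v by (simp add: swap23[of x u v])
      show "DIM(real ^ 'm) = n + 1" using M by simp
    qed (use v pos in simp_all)
    then show ?thesis by simp
  qed
  with M have "hyperbolic_cone F (cone_over H)"
    by (intro hyperbolic_cone_over) (auto simp: h)
  with h show thesis by (rule that)
qed

theorem theorem4p12:
  fixes n :: nat and h :: "real ^ 'm \<Rightarrow> real" and H :: "(real ^ 'm) set"
  assumes "n \<ge> 1" and "CCPSR_manifold n h H"
  shows "\<not> singular_at_infinity h H \<longleftrightarrow> regular_boundary_behaviour h H"
proof
  assume ns: "\<not> singular_at_infinity h H"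
  obtain F where h: "h = (\<lambda>x. F x x x)" and cone: "hyperbolic_cone F (cone_over H)"
    using CCPSR_manifold_hyperbolic_cone[OF assms(2)] by blast
  interpret hyperbolic_cone F "cone_over H" by (rule cone)
  let ?S = "frontier (cone_over H) - {0}"
  have "frechet_derivative h (at p) \<noteq> (\<lambda>v. 0)" if "p \<in> ?S" for p
    using ns that unfolding singular_at_infinity_def by blast
  then have regular: "\<exists>w. F p p w \<noteq> 0" if "p \<in> ?S" for p
    using that unfolding h frechet_derivative_cube by fastforce
  have "psd_on (tangent_space ?S p) (\<lambda>u v. - hessian h p u v) \<and>
    dim (kernel_on (tangent_space ?S p) (\<lambda>u v. - hessian h p u v)) = 1" if p: "p \<in> ?S" for p
  proof -
    obtain w where w: "F p p w \<noteq> 0" using regular[OF p] by blast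
    have p': "p \<in> closure (cone_over H)" "p \<noteq> 0" "F p p p = 0"
      using p frontier_iff by auto
    have T: "tangent_space ?S p = {v. F p p v = 0}"
      by (rule tangent_space_boundary[OF p w])
    have "psd_on (tangent_space ?S p) (\<lambda>u v. - hessian h p u v)"
      using boundary_semidefinite[OF p'(1) w] by (simp add: psd_on_def T h hessian_cube)
    \<comment> \<open>That \<open>p\<close> belongs to the kernel is the tangency condition itself:
      \<open>F p p v = 0\<close> for every tangent \<open>v\<close>.\<close>
    moreover have "kernel_on (tangent_space ?S p) (\<lambda>u v. - hessian h p u v) = span {p}"
    proof (intro equalityI subsetI)
      fix v assume "v \<in> kernel_on (tangent_space ?S p) (\<lambda>u v. - hessian h p u v)"
      then have "F p p v = 0" "\<And>w. F p p w = 0 \<Longrightarrow> F p v w = 0"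
        by (auto simp: kernel_on_def T h hessian_cube)
      with boundary_kernel[OF p regular] show "v \<in> span {p}" by blast
    qed (auto simp: kernel_on_def T h hessian_cube span_singleton p'(3))
    ultimately show ?thesis using p'(2) by (simp add: dim_span)
  qed
  with ns show "regular_boundary_behaviour h H"
    unfolding regular_boundary_behaviour_def singular_at_infinity_def Let_def by blast
qed (auto simp: regular_boundary_behaviour_def singular_at_infinity_def)

end
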